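(* Let $\sigma$ be a special standard $P$-morphism on $\mathcal A$, with $\sigma(x)=pq_x$ for all $x\in\mathcal A$, and let $\mathbf t$ be a rich infinite word over $\mathcal A$. Let $h$ be minimal such that all palindromic factors of $\mathbf t$ of length at most $2$ occur in the prefix $\mathbf t_h$ of length $h$. Then $\sigma(\mathbf t)$ is rich if and only if $\sigma(\mathbf t_h)p$ is rich.
   Context: A finite word $w$ is rich if it has exactly $|w|+1$ distinct palindromic factors (including the empty word); an infinite word is rich if all its factors are rich. A standard $P$-morphism is a morphism $\sigma$ on $\mathcal A$ for which there is a palindrome $p$ (possibly empty) with $\sigma(x)=pq_x$ for all $x$, where each $q_x$ is a palindrome (possibly empty), or, when $p$ is non-empty, $q_x=\pi_x^{-1}$ with $\pi_x$ a proper palindromic suffix of $p$ (i.e. $\sigma(x)$ is $p$ with suffix $\pi_x$ removed). It is special if (1) the words $\sigma(x)$, $x\in\mathcal A$, end with pairwise different letters, and (2) whenever $\sigma(x)p=pq_xp$, $x\in\mathcal A$, occurs as a factor of some word $\sigma(y_1y_2\cdots y_n)p$ ($y_i\in\mathcal A$), this occurrence is the occurrence of $\sigma(y_m)p$ starting right after $\sigma(y_1\cdots y_{m-1})$, for some $1\le m\le n$. *)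

theory Defs
  imports "HOL-Library.Sublist" "HOL-Library.Stream"
begin

definition palindrome :: "'a list \<Rightarrow> bool" where
  "palindrome w \<longleftrightarrow> rev w = w"

definition rich :: "'a list \<Rightarrow> bool" where
  "rich w \<longleftrightarrow> card {u. sublist u w \<and> palindrome u} = length w + 1"

definition stream_factor :: "'a list \<Rightarrow> 'a stream \<Rightarrow> bool" where
  "stream_factor u s \<longleftrightarrow> (\<exists>i n. u = stake n (sdrop i s))"

definition rich_stream :: "'a stream \<Rightarrow> bool" where
  "rich_stream s \<longleftrightarrow> (\<forall>u. stream_factor u s \<longrightarrow> rich u)"

text \<open>A morphism is given by its images of letters; \<open>morph\<close> and \<open>morph_stream\<close> extend it to
  finite and infinite words. The constant \<open>flat\<close> is the infinite concatenation only if all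
  images are non-empty, which holds for special standard P-morphisms (see
  \<open>special_standard_P_morphism\<close>).\<close>

definition morph :: "('a \<Rightarrow> 'a list) \<Rightarrow> 'a list \<Rightarrow> 'a list" where
  "morph \<sigma> w = concat (map \<sigma> w)"

definition morph_stream :: "('a \<Rightarrow> 'a list) \<Rightarrow> 'a stream \<Rightarrow> 'a stream" where
  "morph_stream \<sigma> s = flat (smap \<sigma> s)"

text \<open>The second disjunct is the case where \<open>q\<^sub>x\<close> is the formal inverse of a proper palindromic
  suffix \<open>r\<close> of \<open>p\<close>, so that \<open>\<sigma> x\<close> is \<open>p\<close> with its suffix \<open>r\<close> removed.\<close>

definition standard_P_morphism :: "'a list \<Rightarrow> ('a \<Rightarrow> 'a list) \<Rightarrow> bool" where
  "standard_P_morphism p \<sigma> \<longleftrightarrow>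
     palindrome p \<and>
     (\<forall>x. (\<exists>q. palindrome q \<and> \<sigma> x = p @ q) \<or>
          (p \<noteq> [] \<and> (\<exists>r. palindrome r \<and> strict_suffix r p \<and> \<sigma> x @ r = p)))"

text \<open>In the last condition, \<open>u\<close> and \<open>v\<close> fix the occurrence of \<open>\<sigma> x @ p\<close>; it starts right after
  \<open>\<sigma>\<close> of the first \<open>m\<close> letters of \<open>ys\<close> and is an occurrence of \<open>\<sigma> (ys ! m) @ p\<close>
  (list positions count from 0).\<close>

definition special_standard_P_morphism :: "'a list \<Rightarrow> ('a \<Rightarrow> 'a list) \<Rightarrow> bool" where
  "special_standard_P_morphism p \<sigma> \<longleftrightarrow>
     standard_P_morphism p \<sigma> \<and>
     (\<forall>x. \<sigma> x \<noteq> []) \<and>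
     (\<forall>x y. x \<noteq> y \<longrightarrow> last (\<sigma> x) \<noteq> last (\<sigma> y)) \<and>
     (\<forall>x ys u v. ys \<noteq> [] \<and> morph \<sigma> ys @ p = u @ (\<sigma> x @ p) @ v \<longrightarrow>
        (\<exists>m < length ys. u = morph \<sigma> (take m ys) \<and> \<sigma> x @ p = \<sigma> (ys ! m) @ p))"

end

theory Submission
  imports Defs
begin

text \<open>Put \<open>\<psi>(w) = \<sigma>(w)p\<close>. Since \<open>\<sigma>(x)p\<close> is a palindrome, \<open>\<psi>\<close> commutes with reversal, and condition (2)
  forces every occurrence of \<open>\<psi>(w)\<close>, \<open>w \<noteq> \<epsilon>\<close>, in some \<open>\<psi>(y)\<close> to come from an occurrence of \<open>w\<close> in \<open>y\<close>.
  A word is rich iff each of its prefixes has a palindromic suffix that did not occur before. For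
  \<open>n \<ge> h\<close> the new palindromic suffix of \<open>t\<^sub>n\<^sub>+\<^sub>1\<close> has length at least 3, so it is \<open>xwx\<close> with \<open>w \<noteq> \<epsilon>\<close>.
  Each prefix of \<open>\<psi>(t\<^sub>n\<^sub>+\<^sub>1)\<close> longer than \<open>\<psi>(t\<^sub>n)\<close> then has a palindromic suffix \<open>s \<psi>(w) s\<^sup>R\<close> with \<open>s\<close> a
  nonempty suffix of \<open>\<sigma>(x)\<close>. As the last letter of \<open>s\<close> determines \<open>x\<close>, an earlier occurrence of it
  would yield an earlier occurrence of \<open>xwx\<close>. Hence richness passes from \<open>\<psi>(t\<^sub>n)\<close> to \<open>\<psi>(t\<^sub>n\<^sub>+\<^sub>1)\<close>.\<close>

section \<open>Rich words\<close>

definition pal_factors :: "'a list \<Rightarrow> 'a list set" where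
  "pal_factors w = {u. sublist u w \<and> palindrome u}"

lemma rich_iff_card_pal_factors: "rich w \<longleftrightarrow> card (pal_factors w) = length w + 1"
  by (simp add: rich_def pal_factors_def)

lemma finite_pal_factors: "finite (pal_factors w)"
proof -
  have "pal_factors w \<subseteq> set (sublists w)"
    by (auto simp: pal_factors_def)
  then show ?thesis
    by (rule finite_subset) simp
qed

lemma pal_factors_Nil: "pal_factors [] = {[]}"
  by (auto simp: pal_factors_def palindrome_def)

lemma palindrome_Cons_snoc: "palindrome (y # w @ [x]) \<longleftrightarrow> y = x \<and> palindrome w"
  by (auto simp: palindrome_def)

lemma pal_factors_mono: "sublist u w \<Longrightarrow> pal_factors u \<subseteq> pal_factors w"
  unfolding pal_factors_def using sublist_order.order_trans by blast

text \<open>Reversal fixes \<open>v\<close> and moves its suffix \<open>u\<close> to the front; that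
  copy of \<open>u\<close> ends before the last letter of \<open>v\<close>.\<close>

lemma palindromic_suffix_of_palindromic_suffix_occurs_earlier:
  assumes "palindrome u" "palindrome v" "suffix u (w @ [x])" "suffix v (w @ [x])"
    and "length u < length v"
  shows "sublist u w"
proof -
  have "suffix u v"
    using assms suffix_length_suffix by (metis less_imp_le)
  then have "prefix (rev u) (rev v)"
    by (simp add: suffix_to_prefix)
  then have "prefix u v"
    using assms by (simp add: palindrome_def)
  moreover have "v \<noteq> []"
    using assms by auto
  ultimately have "prefix u (butlast v)"
    using assms(5) by (metis append_butlast_last_id nat_neq_iff prefix_snoc)
  moreover have "suffix (butlast v) w"
    using assms(4) \<open>v \<noteq> []\<close>
    by (metis append_butlast_last_id butlast_snoc snoc_suffix_snoc last_snoc suffix_def last_appendR)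
  ultimately show ?thesis
    by (meson prefix_imp_sublist suffix_imp_sublist sublist_order.order_trans)
qed

lemma new_pal_factor_suffix:
  assumes "u \<in> pal_factors (w @ [x]) - pal_factors w"
  shows "suffix u (w @ [x])" and "palindrome u" and "\<not> sublist u w"
  using assms by (auto simp: pal_factors_def sublist_snoc)

text \<open>The shorter of two distinct new palindromes would already occur in \<open>w\<close>. So
  one more letter adds at most one palindrome, whence the bound \<open>length w + 1\<close>.\<close>

lemma new_pal_factor_unique:
  assumes "u \<in> pal_factors (w @ [x]) - pal_factors w" "v \<in> pal_factors (w @ [x]) - pal_factors w"
  shows "u = v"
proof -
  note u = new_pal_factor_suffix[OF assms(1)] and v = new_pal_factor_suffix[OF assms(2)]
  have "length u = length v"
    using palindromic_suffix_of_palindromic_suffix_occurs_earlier[OF u(2) v(2) u(1) v(1)]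
      palindromic_suffix_of_palindromic_suffix_occurs_earlier[OF v(2) u(2) v(1) u(1)] u(3) v(3)
    by (meson nat_neq_iff)
  then show ?thesis
    using u(1) v(1) by (metis append_eq_append_conv suffix_def)
qed

lemma card_pal_factors_snoc:
  "card (pal_factors (w @ [x])) = card (pal_factors w) +
     (if \<exists>u. palindrome u \<and> suffix u (w @ [x]) \<and> \<not> sublist u w then 1 else 0)"
proof -
  let ?D = "pal_factors (w @ [x]) - pal_factors w"
  have sub: "pal_factors w \<subseteq> pal_factors (w @ [x])"
    by (intro pal_factors_mono) simp
  then have card: "card (pal_factors (w @ [x])) = card (pal_factors w) + card ?D"
    by (metis card_Diff_subset card_mono finite_pal_factors le_add_diff_inverse)
  show ?thesis
  proof (cases "\<exists>u. palindrome u \<and> suffix u (w @ [x]) \<and> \<not> sublist u w")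
    case True
    then obtain u where u: "u \<in> ?D"
      unfolding pal_factors_def using suffix_imp_sublist by blast
    have "?D = {u}"
      using new_pal_factor_unique[OF _ u] u by (intro set_eqI) (metis singleton_iff)
    then show ?thesis
      using True card by (simp only: if_True) simp
  next
    case False
    then have "?D = {}"
      using new_pal_factor_suffix[of _ w x] by (metis equals0I)
    then show ?thesis
      using False card by (simp only: if_False) simp
  qed
qed

lemma card_pal_factors_append: "card (pal_factors (u @ v)) \<le> card (pal_factors u) + length v"
proof (induction v rule: rev_induct)
  case Nil
  then show ?case by simp
next
  case (snoc x v)
  then show ?case
    using card_pal_factors_snoc[of "u @ v" x] by simp
qed

lemma card_pal_factors_le: "card (pal_factors w) \<le> length w + 1"
  using card_pal_factors_append[of "[]" w] by (simp add: pal_factors_Nil)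

text \<open>Each letter of \<open>v\<close> adds at most one palindrome, so \<open>u @ v\<close>
  attains the maximum only if \<open>u\<close> does.\<close>

lemma rich_appendD: "rich (u @ v) \<Longrightarrow> rich u"
  using card_pal_factors_append[of u v] card_pal_factors_le[of u]
  by (simp add: rich_iff_card_pal_factors)

lemma rich_rev: "rich (rev w) \<longleftrightarrow> rich w"
proof -
  have "pal_factors (rev w) = pal_factors w"
    using sublist_rev_right[of _ w] unfolding pal_factors_def palindrome_def
    by (metis (mono_tags, lifting))
  then show ?thesis
    by (simp add: rich_iff_card_pal_factors)
qed

text \<open>Richness passes to prefixes; reversal turns this into passage to suffixes.\<close>

lemma rich_sublist:
  assumes "rich w" "sublist u w"
  shows "rich u"
proof -
  obtain a b where w: "w = a @ u @ b"
    using assms(2) by (auto simp: sublist_def)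
  have "rich (rev (a @ u))"
    using assms(1) rich_appendD[of "a @ u" b] by (simp add: w rich_rev del: rev_append)
  then show ?thesis
    using rich_appendD[of "rev u" "rev a"] by (simp add: rich_rev)
qed

lemma rich_snoc_iff:
  assumes "rich w"
  shows "rich (w @ [x]) \<longleftrightarrow> (\<exists>u. palindrome u \<and> suffix u (w @ [x]) \<and> \<not> sublist u w)"
  using assms card_pal_factors_snoc[of w x] by (auto simp: rich_iff_card_pal_factors)

lemma rich_appendI:
  assumes "rich w"
    and "\<And>k. k < length z \<Longrightarrow>
      \<exists>u. palindrome u \<and> suffix u (w @ take (Suc k) z) \<and> \<not> sublist u (w @ take k z)"
  shows "rich (w @ z)"
proof -
  have "rich (w @ take k z)" if "k \<le> length z" for k
    using that
  proof (induction k)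
    case 0
    then show ?case using assms(1) by simp
  next
    case (Suc k)
    then show ?case
      using rich_snoc_iff[of "w @ take k z" "z ! k"] assms(2)[of k]
      by (simp add: take_Suc_conv_app_nth)
  qed
  from this[of "length z"] show ?thesis by simp
qed

section \<open>Special standard P-morphisms\<close>

lemma morph_Nil [simp]: "morph \<sigma> [] = []"
  and morph_Cons [simp]: "morph \<sigma> (x # w) = \<sigma> x @ morph \<sigma> w"
  and morph_append [simp]: "morph \<sigma> (v @ w) = morph \<sigma> v @ morph \<sigma> w"
  by (simp_all add: morph_def)

text \<open>As \<open>p\<close> is a palindrome, this makes \<open>\<sigma> x @ p\<close> one. It
  equals \<open>p @ q @ p\<close> in the first case; in the second, reversing
  \<open>\<sigma> x @ r = p\<close> gives \<open>p = r @ rev (\<sigma> x)\<close>.\<close>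

lemma standard_P_morphism_rev_letter:
  assumes "standard_P_morphism p \<sigma>"
  shows "p @ rev (\<sigma> x) = \<sigma> x @ p"
proof -
  have p: "rev p = p"
    using assms by (simp add: standard_P_morphism_def palindrome_def)
  consider q where "rev q = q" "\<sigma> x = p @ q" | r where "rev r = r" "\<sigma> x @ r = p"
    using assms unfolding standard_P_morphism_def palindrome_def by metis
  then show ?thesis
  proof cases
    case 1
    then show ?thesis using p by simp
  next
    case 2
    have "p = r @ rev (\<sigma> x)"
      using 2 p by (metis rev_append)
    then show ?thesis
      using 2(2) by (metis append_assoc)
  qed
qed

text \<open>The left side is the reversal of \<open>morph \<sigma> w @ p\<close>. Applied to
  \<open>rev w\<close>, the identity also shows that \<open>morph \<sigma> w @ p\<close> begins with
  \<open>p\<close>.\<close>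

lemma standard_P_morphism_rev:
  assumes "standard_P_morphism p \<sigma>"
  shows "p @ rev (morph \<sigma> w) = morph \<sigma> (rev w) @ p"
proof (induction w)
  case Nil
  then show ?case by simp
next
  case (Cons x w)
  have "p @ rev (morph \<sigma> (x # w)) = morph \<sigma> (rev w) @ p @ rev (\<sigma> x)"
    using Cons by (metis append_assoc morph_Cons rev_append)
  then show ?case
    using standard_P_morphism_rev_letter[OF assms, of x] by simp
qed

lemma standard_P_morphism_palindrome:
  assumes "standard_P_morphism p \<sigma>" "palindrome w"
  shows "palindrome (morph \<sigma> w @ p)"
  using standard_P_morphism_rev[OF assms(1), of w] assms
  by (simp add: palindrome_def standard_P_morphism_def)

lemma length_morph_ge:
  assumes "\<And>x. \<sigma> x \<noteq> []"
  shows "length w \<le> length (morph \<sigma> w)"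
proof (induction w)
  case (Cons x w)
  then show ?case
    using assms[of x] by (cases "\<sigma> x") auto
qed simp

section \<open>Occurrences of images under a special morphism\<close>

locale special_P_morphism =
  fixes p :: "'a list" and \<sigma> :: "'a \<Rightarrow> 'a list"
  assumes special: "special_standard_P_morphism p \<sigma>"
begin

lemma standard: "standard_P_morphism p \<sigma>"
  and image_nonempty: "\<sigma> x \<noteq> []"
  and last_image_inj: "last (\<sigma> x) = last (\<sigma> y) \<Longrightarrow> x = y"
  using special by (auto simp: special_standard_P_morphism_def)

lemma morph_eq_Nil_iff: "morph \<sigma> w = [] \<longleftrightarrow> w = []"
  by (cases w) (auto simp: image_nonempty)

text \<open>Condition (2) yields only \<open>\<sigma> x @ p = \<sigma> (ys ! m) @ p\<close>.
  Cancelling \<open>p\<close> and comparing last letters identifies the letter itself.\<close>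

lemma letter_occurrence:
  assumes "morph \<sigma> ys @ p = u @ \<sigma> x @ p @ v"
  obtains a b where "ys = a @ x # b" "u = morph \<sigma> a"
proof -
  have "ys \<noteq> []"
  proof
    assume "ys = []"
    then have "length p = length (u @ \<sigma> x @ p @ v)"
      using assms by simp
    then show False
      by (simp add: image_nonempty)
  qed
  then obtain m where m: "m < length ys" "u = morph \<sigma> (take m ys)" "\<sigma> x @ p = \<sigma> (ys ! m) @ p"
    using special assms unfolding special_standard_P_morphism_def
    by (metis append_assoc)
  then have "x = ys ! m"
    using last_image_inj by simp
  then show thesis
    using that[of "take m ys" "drop (Suc m) ys"] m by (simp add: id_take_nth_drop[symmetric])
qed

text \<open>Induction on \<open>w\<close>. Since \<open>morph \<sigma> w @ p\<close> begins with
  \<open>p\<close>, the first letter is located by \<open>letter_occurrence\<close>. The rest then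
  starts the remaining image, and only the empty word has empty image, so no letter lies in
  between.\<close>

lemma word_occurrence:
  assumes "w \<noteq> []" "morph \<sigma> ys @ p = u @ morph \<sigma> w @ p @ v"
  shows "\<exists>a b. ys = a @ w @ b \<and> u = morph \<sigma> a"
  using assms
proof (induction w arbitrary: ys u)
  case (Cons x w)
  define c where "c = rev (morph \<sigma> (rev w))"
  have c: "morph \<sigma> w @ p = p @ c"
    using standard_P_morphism_rev[OF standard, of "rev w"] by (simp add: c_def)
  have "morph \<sigma> ys @ p = u @ \<sigma> x @ (morph \<sigma> w @ p) @ v"
    using Cons.prems(2) by simp
  then have "morph \<sigma> ys @ p = u @ \<sigma> x @ p @ (c @ v)"
    by (simp only: c append_assoc)
  then obtain a b where ab: "ys = a @ x # b" "u = morph \<sigma> a"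
    by (rule letter_occurrence)
  show ?case
  proof (cases "w = []")
    case True
    then show ?thesis using ab by auto
  next
    case False
    have "morph \<sigma> b @ p = [] @ morph \<sigma> w @ p @ v"
      using Cons.prems(2) ab by simp
    from Cons.IH[OF False this] obtain a' b' where "b = a' @ w @ b'" "[] = morph \<sigma> a'"
      by blast
    then have "ys = a @ (x # w) @ b'"
      using ab by (metis morph_eq_Nil_iff append_Nil append_Cons)
    then show ?thesis
      using ab by blast
  qed
qed simp

lemma morph_snoc_append:
  "morph \<sigma> (w @ [x]) @ p = morph \<sigma> w @ p @ rev (\<sigma> x)"
  by (simp add: standard_P_morphism_rev_letter[OF standard])

text \<open>The core \<open>w\<close> is located by \<open>word_occurrence\<close>; one letter of
  \<open>s\<close> on each side suffices to force both neighbours of \<open>w\<close> to be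
  \<open>x\<close>. The length equation records how far from the end the occurrence stops.\<close>

lemma trimmed_occurrence:
  assumes w: "w \<noteq> []" and s: "suffix s (\<sigma> x)" "s \<noteq> []"
    and occ: "morph \<sigma> ys @ p = A @ (s @ morph \<sigma> w @ p @ rev s) @ B"
  obtains a b where "ys = a @ x # w @ x # b" "length s + length B = length (morph \<sigma> (x # b))"
proof -
  have last_s: "last s = last (\<sigma> x)"
    using s by (auto simp: suffix_def)
  have "morph \<sigma> ys @ p = (A @ s) @ morph \<sigma> w @ p @ (rev s @ B)"
    using occ by simp
  from word_occurrence[OF w this]
  obtain a' b' where ys: "ys = a' @ w @ b'" and a': "A @ s = morph \<sigma> a'"
    by blast
  have b': "morph \<sigma> b' @ p = p @ rev s @ B"
    using occ unfolding ys by (simp add: a'[symmetric])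
  have "a' \<noteq> []"
    using a' s by auto
  then obtain a y where ay: "a' = a @ [y]"
    by (metis append_butlast_last_id)
  have "last (\<sigma> y) = last s"
    using arg_cong[OF a', of last] s image_nonempty[of y] by (simp add: ay)
  then have y: "y = x"
    using last_s last_image_inj by simp
  have "b' \<noteq> []"
    using b' s by auto
  then obtain z b where zb: "b' = z # b"
    by (cases b') auto
  \<comment> \<open>Moving \<open>p\<close> to the front exposes \<open>rev (\<sigma> z)\<close>
    right after it, where \<open>rev s\<close> also starts; their first letters are the last letters
    of \<open>\<sigma> z\<close> and \<open>s\<close>.\<close>
  have "morph \<sigma> b' @ p = \<sigma> z @ p @ rev (morph \<sigma> (rev b))"
    using standard_P_morphism_rev[OF standard, of "rev b"] by (simp add: zb)
  also have "\<dots> = p @ rev (\<sigma> z) @ rev (morph \<sigma> (rev b))"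
    using standard_P_morphism_rev_letter[OF standard, of z] by (metis append_assoc)
  finally have "rev s @ B = rev (\<sigma> z) @ rev (morph \<sigma> (rev b))"
    using b' by simp
  from arg_cong[OF this, of hd] have "last s = last (\<sigma> z)"
    using s image_nonempty[of z] by (simp add: hd_append hd_rev)
  then have z: "z = x"
    using last_s last_image_inj by simp
  have "length s + length B = length (morph \<sigma> (x # b))"
    using arg_cong[OF b', of length] by (simp add: zb z)
  then show thesis
    using that[of a b] by (simp add: ys ay zb y z)
qed

lemma rich_extend:
  assumes rich: "rich (morph \<sigma> v @ p)"
    and pal: "palindrome w" and w: "w \<noteq> []"
    and suf: "suffix (x # w @ [x]) (v @ [x])" and new: "\<not> sublist (x # w @ [x]) v"
  shows "rich (morph \<sigma> (v @ [x]) @ p)"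
proof -
  obtain c where v: "v = c @ x # w"
    using suf by (auto simp: suffix_def)
  let ?V = "morph \<sigma> v @ p" and ?z = "rev (\<sigma> x)"
  have "rich (?V @ ?z)"
  proof (rule rich_appendI[OF rich])
    fix k assume k: "k < length ?z"
    \<comment> \<open>\<open>rev s\<close> is the part of \<open>?z\<close> appended so far,
      including the current letter, so \<open>s\<close> is a suffix of \<open>\<sigma> x\<close> and
      \<open>?P\<close> ends exactly at that letter.\<close>
    define s where "s = rev (take (Suc k) ?z)"
    let ?P = "s @ morph \<sigma> w @ p @ rev s"
    have s: "suffix s (\<sigma> x)" "s \<noteq> []" "length s = Suc k"
      using k by (auto simp: s_def suffix_to_prefix take_is_prefix image_nonempty)
    have "palindrome ?P"
      using standard_P_morphism_palindrome[OF standard pal] by (simp add: palindrome_def)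
    moreover have "suffix ?P (?V @ take (Suc k) ?z)"
    proof -
      obtain d where "\<sigma> x = d @ s"
        using s by (auto simp: suffix_def)
      then have "?V @ take (Suc k) ?z = (morph \<sigma> c @ d) @ ?P"
        by (simp add: v s_def)
      then show ?thesis
        unfolding suffix_def by blast
    qed
    moreover have "\<not> sublist ?P (?V @ take k ?z)"
    proof
      assume "sublist ?P (?V @ take k ?z)"
      then obtain A C where AC: "?V @ take k ?z = A @ ?P @ C"
        by (auto simp: sublist_def)
      \<comment> \<open>The missing letters of \<open>?z\<close> are added so that the occurrence
        lies in a full image, as \<open>trimmed_occurrence\<close> requires.\<close>
      let ?B = "C @ drop k ?z"
      have "morph \<sigma> (v @ [x]) @ p = (?V @ take k ?z) @ drop k ?z"
        using morph_snoc_append[of v x] by simp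
      also have "\<dots> = A @ ?P @ ?B"
        by (subst AC) simp
      finally have "morph \<sigma> (v @ [x]) @ p = A @ ?P @ ?B" .
      then obtain a b where ab: "v @ [x] = a @ x # w @ x # b"
        "length s + length ?B = length (morph \<sigma> (x # b))"
        using trimmed_occurrence[OF w s(1,2)] by blast
      \<comment> \<open>\<open>?B\<close> has at least \<open>length ?z - k\<close> letters and
        \<open>s\<close> has \<open>k + 1\<close>: together more than \<open>\<sigma> x\<close>
        alone. Hence \<open>x # w @ [x]\<close> ends before the final letter, inside
        \<open>v\<close>.\<close>
      have "b \<noteq> []"
        using ab(2) s(3) k by auto
      then have "v = a @ (x # w @ [x]) @ butlast b"
        using arg_cong[OF ab(1), of butlast] by (simp add: butlast_append)
      then show False
        using new by (auto simp: sublist_def)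
    qed
    ultimately show "\<exists>u. palindrome u \<and> suffix u (?V @ take (Suc k) ?z)
        \<and> \<not> sublist u (?V @ take k ?z)"
      by blast
  qed
  then show ?thesis
    using morph_snoc_append[of v x] by simp
qed

end

section \<open>Factors of infinite words\<close>

lemma stream_factor_iff_sublist_stake: "stream_factor u s \<longleftrightarrow> (\<exists>n. sublist u (stake n s))"
proof
  assume "stream_factor u s"
  then obtain i n where "u = stake n (sdrop i s)"
    by (auto simp: stream_factor_def)
  then have "stake (i + n) s = stake i s @ u @ []"
    by (simp flip: stake_add)
  then show "\<exists>n. sublist u (stake n s)"
    unfolding sublist_def by blast
next
  assume "\<exists>n. sublist u (stake n s)"
  then obtain n a b where ab: "stake n s = a @ u @ b"
    by (auto simp: sublist_def)
  then have "s = a @- u @- b @- sdrop n s"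
    by (metis stake_sdrop shift_append)
  then have "u = stake (length u) (sdrop (length a) s)"
    by (metis sdrop_shift stake_shift append_Nil2 diff_self_eq_0 drop_all order_refl sdrop.simps(1)
        shift.simps(1) stake.simps(1) take_all)
  then show "stream_factor u s"
    unfolding stream_factor_def by blast
qed

lemma stake_mono_prefix: "m \<le> n \<Longrightarrow> prefix (stake m s) (stake n s)"
  by (metis le_add_diff_inverse prefixI stake_add)

lemma rich_stream_iff: "rich_stream s \<longleftrightarrow> (\<forall>n. rich (stake n s))"
  unfolding rich_stream_def stream_factor_iff_sublist_stake
  using rich_sublist by blast

text \<open>Over a finite alphabet there are finitely many short factors, so the longest of the
  prefixes needed for each suffices. This makes the minimal \<open>h\<close> of the theorem
  exist.\<close>

lemma prefix_containing_short_factors: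
  fixes s :: "'a::finite stream"
  obtains n where "\<And>u. stream_factor u s \<Longrightarrow> length u \<le> k \<Longrightarrow> sublist u (stake n s)"
proof -
  let ?F = "{u. stream_factor u s \<and> length u \<le> k}"
  have "finite ?F"
    by (rule finite_subset[OF _ finite_lists_length_le[of UNIV k]]) auto
  moreover obtain N where N: "\<And>u. u \<in> ?F \<Longrightarrow> sublist u (stake (N u) s)"
    using stream_factor_iff_sublist_stake[of _ s] by (metis (mono_tags, lifting) mem_Collect_eq)
  ultimately have "sublist u (stake (Max (N ` ?F)) s)" if "u \<in> ?F" for u
    using that stake_mono_prefix[of "N u" "Max (N ` ?F)" s]
    by (meson Max_ge finite_imageI imageI prefix_imp_sublist sublist_order.order_trans)
  then show thesis
    using that by blast
qed

lemma morph_stream_unfold: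
  assumes "\<And>x. \<sigma> x \<noteq> []"
  shows "morph_stream \<sigma> s = morph \<sigma> (stake n s) @- morph_stream \<sigma> (sdrop n s)"
proof (induction n arbitrary: s)
  case (Suc n)
  have "morph_stream \<sigma> s = \<sigma> (shd s) @- morph_stream \<sigma> (stl s)"
    unfolding morph_stream_def using assms by (subst flat_unfold) auto
  then show ?case
    using Suc[of "stl s"] by simp
qed simp

lemma prefix_stake_morph_stream:
  assumes "\<And>x. \<sigma> x \<noteq> []"
  shows "prefix (stake n (morph_stream \<sigma> s)) (morph \<sigma> (stake n s))"
proof -
  have "n \<le> length (morph \<sigma> (stake n s))"
    using length_morph_ge[OF assms, of "stake n s"] by simp
  then have "stake n (morph_stream \<sigma> s) = take n (morph \<sigma> (stake n s))"
    by (subst morph_stream_unfold[where n = n, OF assms]) (simp add: stake_shift)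
  then show ?thesis
    by (simp add: take_is_prefix)
qed

lemma stream_factor_morph_stream:
  assumes "\<And>x. \<sigma> x \<noteq> []" "sublist u (morph \<sigma> (stake n s))"
  shows "stream_factor u (morph_stream \<sigma> s)"
proof -
  have "stake (length (morph \<sigma> (stake n s))) (morph_stream \<sigma> s) = morph \<sigma> (stake n s)"
    by (subst morph_stream_unfold[where n = n, OF assms(1)]) (simp add: stake_shift)
  then show ?thesis
    using assms(2) stream_factor_iff_sublist_stake by metis
qed

section \<open>Richness of the images of prefixes\<close>

context special_P_morphism
begin

text \<open>The image of the next \<open>length p\<close> letters has length at least
  \<open>length p\<close>, and followed by \<open>p\<close> it begins with \<open>p\<close>; so it
  begins with \<open>p\<close> by itself.\<close>

lemma stream_factor_morph_append:
  "stream_factor (morph \<sigma> (stake n s) @ p) (morph_stream \<sigma> s)"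
proof (rule stream_factor_morph_stream[OF image_nonempty])
  let ?v = "stake (length p) (sdrop n s)"
  have "prefix p (morph \<sigma> ?v @ p)"
    using standard_P_morphism_rev[OF standard, of "rev ?v"] by (metis prefixI rev_rev_ident)
  moreover have "length p \<le> length (morph \<sigma> ?v)"
    using length_morph_ge[OF image_nonempty, of ?v] by simp
  ultimately have "prefix p (morph \<sigma> ?v)"
    using prefix_length_prefix by (metis prefixI)
  moreover have "morph \<sigma> (stake (n + length p) s) = morph \<sigma> (stake n s) @ morph \<sigma> ?v"
    by (simp flip: stake_add)
  ultimately show "sublist (morph \<sigma> (stake n s) @ p) (morph \<sigma> (stake (n + length p) s))"
    by (simp add: prefix_imp_sublist)
qed

lemma rich_morph_stake:
  assumes t: "rich_stream t"
    and h: "\<And>u. stream_factor u t \<Longrightarrow> palindrome u \<Longrightarrow> length u \<le> 2 \<Longrightarrow> sublist u (stake h t)"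
    and rich: "rich (morph \<sigma> (stake h t) @ p)" and n: "h \<le> n"
  shows "rich (morph \<sigma> (stake n t) @ p)"
  using n
proof (induction n rule: dec_induct)
  case base
  then show ?case by (rule rich)
next
  case (step n)
  let ?x = "t !! n"
  have Suc_n: "stake (Suc n) t = stake n t @ [?x]"
    by (rule stake_Suc)
  then obtain u where u: "palindrome u" "suffix u (stake n t @ [?x])" "\<not> sublist u (stake n t)"
    using t rich_snoc_iff[of "stake n t" ?x] unfolding rich_stream_iff by metis
  \<comment> \<open>A palindrome of length at most 2 already occurs in the prefix of length
    \<open>h\<close>, hence is not new.\<close>
  have "length u > 2"
  proof (rule ccontr)
    assume "\<not> length u > 2"
    moreover have "stream_factor u t"
      using u(2) Suc_n stream_factor_iff_sublist_stake by (metis suffix_imp_sublist)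
    ultimately have "sublist u (stake h t)"
      using h u(1) by simp
    then show False
      using u(3) stake_mono_prefix[OF step.hyps(1), of t]
      by (meson prefix_imp_sublist sublist_order.order_trans)
  qed
  \<comment> \<open>Length at least 3 leaves a nonempty centre \<open>w\<close>, which
    \<open>rich_extend\<close> requires.\<close>
  then obtain y w where yw: "u = y # w @ [?x]" "w \<noteq> []"
  proof -
    obtain y u' where u': "u = y # u'" "u' \<noteq> []"
      using \<open>length u > 2\<close> by (cases u; cases "tl u") auto
    moreover have "last u = ?x"
      using u(2) u' by (metis last_appendR last_snoc list.distinct(1) suffix_def)
    ultimately show thesis
      using that[of y "butlast u'"] \<open>length u > 2\<close>
      by (cases u' rule: rev_cases) auto
  qed
  have y: "y = ?x" and w: "palindrome w"
    using u(1) unfolding yw(1) palindrome_Cons_snoc by blast+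
  show ?case
    unfolding Suc_n using rich_extend[OF step.IH w yw(2)] u(2,3) unfolding yw(1) y by blast
qed

end

theorem theorem6p15:
  fixes \<sigma> :: "'a::finite \<Rightarrow> 'a list" and p :: "'a list" and t :: "'a stream" and h :: nat
  assumes "special_standard_P_morphism p \<sigma>"
    and "rich_stream t"
    and "h = (LEAST n. \<forall>u. stream_factor u t \<and> palindrome u \<and> length u \<le> 2
                        \<longrightarrow> sublist u (stake n t))"
  shows "rich_stream (morph_stream \<sigma> t) \<longleftrightarrow> rich (morph \<sigma> (stake h t) @ p)"
proof -
  interpret special_P_morphism p \<sigma>
    using assms(1) by unfold_locales
  have "\<exists>n. \<forall>u. stream_factor u t \<and> palindrome u \<and> length u \<le> 2 \<longrightarrow> sublist u (stake n t)"
    by (rule prefix_containing_short_factors[of t 2]) blast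
  from LeastI_ex[OF this]
  have h: "sublist u (stake h t)" if "stream_factor u t" "palindrome u" "length u \<le> 2" for u
    using that unfolding assms(3) by blast
  show ?thesis
  proof
    assume "rich_stream (morph_stream \<sigma> t)"
    then show "rich (morph \<sigma> (stake h t) @ p)"
      using stream_factor_morph_append unfolding rich_stream_def by blast
  next
    assume rich: "rich (morph \<sigma> (stake h t) @ p)"
    have "rich (stake n (morph_stream \<sigma> t))" for n
    proof -
      \<comment> \<open>At least \<open>h\<close>, for \<open>rich_morph_stake\<close>; at least
        \<open>n\<close>, so that the image covers the first \<open>n\<close> letters of
        \<open>morph_stream \<sigma> t\<close>.\<close>
      let ?N = "max h n"
      have "prefix (stake n (morph_stream \<sigma> t)) (stake ?N (morph_stream \<sigma> t))"
        by (intro stake_mono_prefix) simp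
      also have "prefix \<dots> (morph \<sigma> (stake ?N t))"
        by (rule prefix_stake_morph_stream[OF image_nonempty])
      also have "prefix \<dots> (morph \<sigma> (stake ?N t) @ p)"
        by simp
      finally have "sublist (stake n (morph_stream \<sigma> t)) (morph \<sigma> (stake ?N t) @ p)"
        by (rule prefix_imp_sublist)
      then show ?thesis
        using rich_morph_stake[OF assms(2) h rich, of ?N] rich_sublist by simp
    qed
    then show "rich_stream (morph_stream \<sigma> t)"
      by (simp add: rich_stream_iff)
  qed
qed

end
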